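(* Let $q\ge3$ be an integer, let $n$ be an integer with $3\nmid n$, and suppose $n\ge45q-60$. If $G$ is an oriented graph on $n$ vertices with $\delta^0(G)\ge\lceil n/3\rceil$, then every vertex of $G$ lies on a copy of $C_{3q}$ in $G$.
   Context: An oriented graph is an orientation of a (finite) simple graph: no loops, and at most one arc on each unordered pair of vertices. $\delta^0(G)=\min_{v}\min\{d^+(v),d^-(v)\}$ is the minimum semidegree. $C_\ell$ denotes the consistently oriented (directed) cycle of length $\ell$ (with $\ell$ distinct vertices). *)

theory Defs
  imports Complex_Main "Graph_Theory.Arc_Walk"
begin

text \<open>A \<open>digraph\<close> is finite, loop-free and has no parallel arcs; asymmetry additionally
  rules out a pair of opposite arcs, leaving at most one arc on each unordered pair of vertices.\<close>

locale oriented_graph = digraph +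
  assumes asym_arcs: "asym (arcs_ends G)"

text \<open>Meaningful only if the vertex set is finite and nonempty.\<close>

definition min_semidegree :: "('a, 'b) pre_digraph \<Rightarrow> nat" where
  "min_semidegree G = Min ((\<lambda>v. min (out_degree G v) (in_degree G v)) ` verts G)"

text \<open>A copy of the directed cycle of length \<open>l\<close> is given by its list of arcs: a closed
  arc walk \<open>p\<close> with \<open>l\<close> arcs and no repeated vertex (\<open>pre_digraph.cycle\<close>). Its vertices are
  the tails of the arcs in \<open>p\<close>.\<close>

definition on_directed_cycle :: "('a, 'b) pre_digraph \<Rightarrow> nat \<Rightarrow> 'a \<Rightarrow> bool" where
  "on_directed_cycle G l v \<longleftrightarrow>
     (\<exists>p. pre_digraph.cycle G p \<and> length p = l \<and> v \<in> tail G ` set p)"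

end

theory Submission
  imports Defs
begin

text \<open>Write \<open>l = 3q\<close> and let \<open>d\<close> be the minimum semidegree, so that \<open>n < 3d\<close>. An out-neighbourhood
  is never independent, since a vertex in an independent one would have its in-, its
  out-neighbours and that set as three disjoint sets of size at least \<open>d\<close>; likewise for
  in-neighbourhoods. Hence there are arcs \<open>b \<rightarrow> y\<close> inside the out-neighbourhood and \<open>x \<rightarrow> a\<close> inside
  the in-neighbourhood of \<open>v\<close>. As \<open>b\<close> and \<open>a\<close> are optional detours, any path from \<open>y\<close> to \<open>x\<close>
  avoiding \<open>v, a, b\<close> with \<open>l - 3\<close>, \<open>l - 2\<close> or \<open>l - 1\<close> vertices closes up to the desired cycle.

  Walk greedily \<open>l - 9\<close> steps from \<open>y\<close> to some \<open>z\<close>, and let \<open>X\<close> be the set of unused out-neighbours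
  of \<open>z\<close>. If some vertex of \<open>X\<close> has no out-neighbour in \<open>X\<close>, then the out-ball of radius 2 around \<open>z\<close>
  is large, so \<open>z\<close> reaches the third greedy predecessor of \<open>x\<close> in 2 to 4 steps. Otherwise \<open>X\<close>
  contains a path \<open>w1 \<rightarrow> w2 \<rightarrow> w3\<close>, so \<open>w3\<close> can be reached from \<open>z\<close> in 1, 2 or 3 steps, and a ball
  counting argument joins \<open>w3\<close> to \<open>x\<close> in 2 to 6 steps. In both cases the available choices
  cover all required lengths. The counting rests on the fact that every set \<open>S\<close> contains a vertex
  with fewer than \<open>|S|/2\<close> out-neighbours inside \<open>S\<close>, so balls grow quickly.\<close>

section \<open>Paths as vertex lists, and balls avoiding a forbidden set\<close>

definition is_path :: "('a \<Rightarrow> 'a \<Rightarrow> bool) \<Rightarrow> 'a list \<Rightarrow> bool" where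
  "is_path E p \<longleftrightarrow> p \<noteq> [] \<and> distinct p \<and> successively E p"

lemma is_path_append:
  "is_path E p \<Longrightarrow> is_path E q \<Longrightarrow> E (last p) (hd q) \<Longrightarrow> set p \<inter> set q = {} \<Longrightarrow> is_path E (p @ q)"
  by (auto simp: is_path_def successively_append_iff)

lemma is_path_rev: "is_path E (rev p) \<longleftrightarrow> is_path (\<lambda>x y. E y x) p"
  by (simp add: is_path_def)

lemma walk_imp_path:
  assumes "successively E p" "p \<noteq> []"
  shows "\<exists>q. is_path E q \<and> hd q = hd p \<and> last q = last p \<and> set q \<subseteq> set p \<and> length q \<le> length p"
  using assms
proof (induction "length p" arbitrary: p rule: less_induct)
  case less
  show ?case
  proof (cases "distinct p")
    case True
    then show ?thesis using less.prems by (auto simp: is_path_def)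
  next
    case False
    then obtain as bs cs y where p: "p = as @ [y] @ bs @ [y] @ cs"
      using not_distinct_decomp by blast
    let ?p = "as @ [y] @ cs"
    have "successively E ?p" using less.prems(1) unfolding p
      by (auto simp: successively_append_iff successively_Cons)
    then obtain q where "is_path E q" "hd q = hd ?p" "last q = last ?p"
        "set q \<subseteq> set ?p" "length q \<le> length ?p"
      using less.hyps[of ?p] by (auto simp: p)
    moreover have "hd ?p = hd p" by (cases as) (auto simp: p)
    moreover have "last ?p = last p" by (auto simp: p)
    ultimately show ?thesis by (intro exI[of _ q]) (auto simp: p)
  qed
qed

text \<open>The \<open>k\<close>-fold iterate is the ball of radius \<open>k\<close> around
  \<open>S\<close> when entering \<open>U\<close> is forbidden. Out-balls come from
  \<open>E\<close>, in-balls from its converse.\<close>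

definition grow :: "('a \<Rightarrow> 'a \<Rightarrow> bool) \<Rightarrow> 'a set \<Rightarrow> 'a set \<Rightarrow> 'a set" where
  "grow E U S = S \<union> {y. y \<notin> U \<and> (\<exists>s\<in>S. E s y)}"

lemma grow_disjoint: "S \<inter> U = {} \<Longrightarrow> grow E U S \<inter> U = {}"
  by (auto simp: grow_def)

lemma walk_if_in_grow:
  assumes "X \<inter> U = {}" "c \<in> (grow E U ^^ k) X"
  shows "\<exists>p. p \<noteq> [] \<and> successively E p \<and> hd p \<in> X \<and> last p = c \<and> set p \<inter> U = {} \<and> length p \<le> Suc k"
  using assms(2)
proof (induction k arbitrary: c)
  case 0
  then show ?case using assms(1) by (intro exI[of _ "[c]"]) auto
next
  case (Suc k)
  then have "c \<in> grow E U ((grow E U ^^ k) X)" by simp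
  then consider "c \<in> (grow E U ^^ k) X"
    | s where "s \<in> (grow E U ^^ k) X" "E s c" "c \<notin> U" unfolding grow_def[of E U] by blast
  then show ?case
  proof cases
    case 1
    then show ?thesis using Suc.IH le_SucI by blast
  next
    case 2
    then obtain p where "p \<noteq> []" "successively E p" "hd p \<in> X" "last p = s"
        "set p \<inter> U = {}" "length p \<le> Suc k"
      using Suc.IH by blast
    then show ?thesis using 2
      by (intro exI[of _ "p @ [c]"]) (auto simp: successively_append_iff)
  qed
qed

text \<open>An out-ball and an in-ball sharing a vertex yield two walks to splice there. Cutting the
  result down to a path leaves only an upper bound on the length, so callers must cope with every
  shorter path.\<close>

lemma path_between_grow:
  assumes "X \<inter> U = {}" "Y \<inter> U = {}"
    and "(grow E U ^^ k) X \<inter> (grow (\<lambda>x y. E y x) U ^^ m) Y \<noteq> {}"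
  shows "\<exists>p. is_path E p \<and> hd p \<in> X \<and> last p \<in> Y \<and> set p \<inter> U = {} \<and> length p \<le> Suc (k + m)"
proof -
  obtain c where c: "c \<in> (grow E U ^^ k) X" "c \<in> (grow (\<lambda>x y. E y x) U ^^ m) Y"
    using assms(3) by blast
  obtain p where p: "p \<noteq> []" "successively E p" "hd p \<in> X" "last p = c" "set p \<inter> U = {}"
      "length p \<le> Suc k"
    using walk_if_in_grow[OF assms(1) c(1)] by blast
  obtain q where q: "q \<noteq> []" "successively (\<lambda>x y. E y x) q" "hd q \<in> Y" "last q = c"
      "set q \<inter> U = {}" "length q \<le> Suc m"
    using walk_if_in_grow[OF assms(2) c(2)] by blast
  \<comment> \<open>Dropping the shared vertex \<open>c\<close> from the second walk makes the bound
    \<open>Suc (k + m)\<close> and not one more.\<close>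
  obtain r where r: "rev q = c # r"
    using q(1,4) by (cases q rule: rev_cases) auto
  let ?w = "p @ r"
  have "successively E (rev q)" using q(2) by simp
  then have "successively E ?w" using p(1,2,4) r
    by (auto simp: successively_append_iff successively_Cons)
  moreover have "last ?w = last (rev q)" using p(1,4) r by auto
  then have "last ?w \<in> Y" using q(1,3) by (simp add: last_rev)
  moreover have "set q = insert c (set r)" using arg_cong[OF r, of set] by simp
  then have "set ?w \<inter> U = {}" using p(5) q(5) by auto
  moreover have "length q = Suc (length r)" using arg_cong[OF r, of length] by simp
  then have "length ?w \<le> Suc (k + m)" using p(6) q(6) by simp
  moreover have "hd ?w \<in> X" "?w \<noteq> []" using p(1,3) by auto
  moreover obtain w where "is_path E w" "hd w = hd ?w" "last w = last ?w" "set w \<subseteq> set ?w"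
      "length w \<le> length ?w"
    using walk_imp_path[of E ?w] calculation by blast
  ultimately show ?thesis
    by (intro exI[of _ w]) auto
qed

section \<open>Degree counting and greedy paths\<close>

locale semidegree =
  fixes V :: "'a set" and E :: "'a \<Rightarrow> 'a \<Rightarrow> bool" and d :: nat
  assumes finite_V: "finite V"
    and in_V: "E x y \<Longrightarrow> x \<in> V \<and> y \<in> V"
    and asymm: "E x y \<Longrightarrow> \<not> E y x"
    and out_deg: "x \<in> V \<Longrightarrow> d \<le> card {y. E x y}"
    and in_deg: "x \<in> V \<Longrightarrow> d \<le> card {y. E y x}"
begin

text \<open>Interpreting the locale for the converse relation turns each statement on out-neighbours
  into one on in-neighbours.\<close>

lemma converse: "semidegree V (\<lambda>x y. E y x) d"
  by unfold_locales (use finite_V in_V asymm out_deg in_deg in auto)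

lemma finite_nbrs [simp]: "finite {y. E x y}" "finite {y. E y x}"
  by (rule finite_subset[OF _ finite_V], use in_V in auto)+

lemma irrefl: "\<not> E x x"
  using asymm by blast

lemma arc_in_out_nbrs:
  assumes "v \<in> V" "card V < 3 * d"
  shows "\<exists>b y. E v b \<and> E v y \<and> E b y"
proof (rule ccontr)
  assume no: "\<not> ?thesis"
  have "d > 0" using assms by (cases d) auto
  then have "{y. E v y} \<noteq> {}" using out_deg[OF assms(1)] by (metis card.empty not_le)
  then obtain i where i: "E v i" by blast
  have "card {y. E i y} + card {y. E y i} + card {y. E v y}
      = card ({y. E i y} \<union> {y. E y i} \<union> {y. E v y})"
  proof -
    have "{y. E i y} \<inter> {y. E y i} = {}" "({y. E i y} \<union> {y. E y i}) \<inter> {y. E v y} = {}"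
      using no i asymm by blast+
    then show ?thesis by (simp add: card_Un_disjoint)
  qed
  also have "\<dots> \<le> card V" by (intro card_mono finite_V) (use in_V in auto)
  finally show False
    using assms out_deg[OF assms(1)] out_deg[of i] in_deg[of i] in_V[OF i] by simp
qed

text \<open>The arcs inside \<open>S\<close>, their reversals and the diagonal are disjoint subsets
  of \<open>S \<times> S\<close>, so the average inner out-degree is at most
  \<open>(card S - 1) / 2\<close>.\<close>

lemma ex_small_inner_out_deg:
  assumes "finite S" "S \<noteq> {}"
  shows "\<exists>s\<in>S. 2 * card {y \<in> S. E s y} < card S"
proof (rule ccontr)
  assume "\<not> ?thesis"
  then have "card S \<le> 2 * card {y \<in> S. E s y}" if "s \<in> S" for s using that by force
  then have "(\<Sum>s\<in>S. card S) \<le> (\<Sum>s\<in>S. 2 * card {y \<in> S. E s y})" by (intro sum_mono)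
  then have le: "card S * card S \<le> 2 * (\<Sum>s\<in>S. card {y \<in> S. E s y})"
    by (simp add: sum_distrib_left)
  let ?A = "Sigma S (\<lambda>s. {y \<in> S. E s y})"
  have A: "finite ?A" "card ?A = (\<Sum>s\<in>S. card {y \<in> S. E s y})" using assms by auto
  have "card (prod.swap ` ?A) = card ?A" by (intro card_image inj_onI) auto
  moreover have "card (?A \<union> prod.swap ` ?A \<union> (\<lambda>s. (s, s)) ` S)
      = card ?A + card (prod.swap ` ?A) + card ((\<lambda>s. (s, s)) ` S)"
    using A(1) assms(1) asymm irrefl by (subst card_Un_disjoint; (subst card_Un_disjoint)?) auto
  moreover have "card ((\<lambda>s. (s, s)) ` S) = card S" by (intro card_image inj_onI) auto
  moreover have "card (?A \<union> prod.swap ` ?A \<union> (\<lambda>s. (s, s)) ` S) \<le> card (S \<times> S)"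
    using assms(1) by (intro card_mono) auto
  ultimately have "2 * card ?A + card S \<le> card S * card S" by (simp add: card_cartesian_product)
  moreover have "card S > 0" using assms by (simp add: card_gt_0_iff)
  ultimately show False using le A(2) by simp
qed

text \<open>Deleting \<open>U\<close> can cost \<open>s\<close> only the out-neighbours in
  \<open>U - K\<close>.\<close>

lemma card_out_nbrs_diff:
  assumes "s \<in> V" "finite U" "K \<subseteq> U" "\<And>k. k \<in> K \<Longrightarrow> \<not> E s k"
  shows "d + card K \<le> card ({y. E s y} - U) + card U"
proof -
  have "{y. E s y} - U = {y. E s y} - (U - K)" using assms by auto
  moreover have "card {y. E s y} \<le> card ({y. E s y} - (U - K)) + card (U - K)"
    using diff_card_le_card_Diff[of "U - K" "{y. E s y}"] assms by simp
  moreover have "card U = card (U - K) + card K"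
    using assms by (metis card_Diff_subset card_mono finite_subset le_add_diff_inverse2)
  ultimately show ?thesis using out_deg[OF assms(1)] by simp
qed

lemma finite_grow: "finite S \<Longrightarrow> finite (grow E U S)"
  unfolding grow_def by (intro finite_UnI) (auto intro: finite_subset[OF _ finite_V] dest: in_V)

lemma grow_subset_V: "S \<subseteq> V \<Longrightarrow> grow E U S \<subseteq> V"
  unfolding grow_def using in_V by auto

text \<open>Vertices of \<open>K\<close> are forbidden but cost no out-degree. The lower bound on \<open>n\<close> is too tight
  to count every forbidden vertex as a lost neighbour.\<close>

lemma card_grow:
  assumes "S \<subseteq> V" "S \<noteq> {}" "finite U" "K \<subseteq> U" "\<And>s k. s \<in> S \<Longrightarrow> k \<in> K \<Longrightarrow> \<not> E s k"
  shows "card S + 1 + 2 * d + 2 * card K \<le> 2 * card (grow E U S) + 2 * card U"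
proof -
  have fS: "finite S" using assms(1) finite_V finite_subset by blast
  obtain s where s: "s \<in> S" "2 * card {y \<in> S. E s y} < card S"
    using ex_small_inner_out_deg[OF fS assms(2)] by blast
  let ?N = "{y. E s y} - U"
  \<comment> \<open>Of the out-neighbours of \<open>s\<close> outside \<open>U\<close>, fewer than
    \<open>card S / 2\<close> lie in \<open>S\<close>; the others are new. That strict inequality is
    the source of the \<open>+ 1\<close>.\<close>
  have "d + card K \<le> card ?N + card U" using s assms by (intro card_out_nbrs_diff) auto
  moreover have "card ?N \<le> card (?N - S) + card {y \<in> S. E s y}"
    using card_mono[of "(?N - S) \<union> {y \<in> S. E s y}" ?N] fS
    by (intro order_trans[OF _ card_Un_le]) auto
  moreover have "card S + card (?N - S) \<le> card (grow E U S)"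
    using s fS by (subst card_Un_disjoint[symmetric])
      (auto intro!: card_mono finite_grow simp: grow_def)
  ultimately show ?thesis using s(2) by linarith
qed

text \<open>Before each extension, \<open>F\<close> and the path so far have fewer than
  \<open>d\<close> vertices together, so some out-neighbour of the end is free.\<close>

lemma ex_path_from:
  assumes "y \<in> V" "finite F" "y \<notin> F" "card F + j < d"
  shows "\<exists>p. is_path E p \<and> length p = Suc j \<and> hd p = y \<and> set p \<inter> F = {} \<and> set p \<subseteq> V"
  using assms(4)
proof (induction j)
  case 0
  show ?case using assms by (intro exI[of _ "[y]"]) (auto simp: is_path_def)
next
  case (Suc j)
  then obtain p where p: "is_path E p" "length p = Suc j" "hd p = y" "set p \<inter> F = {}" "set p \<subseteq> V"
    by auto
  have ne: "p \<noteq> []" using p(1) by (simp add: is_path_def)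
  then have "last p \<in> V" using p(5) by auto
  moreover have "card (F \<union> set p) < d"
    using card_Un_le[of F "set p"] card_length[of p] p(2) Suc.prems by simp
  ultimately have "\<not> {w. E (last p) w} \<subseteq> F \<union> set p"
    using out_deg[of "last p"] card_mono[of "F \<union> set p" "{w. E (last p) w}"] assms(2) by force
  then obtain w where w: "E (last p) w" "w \<notin> F" "w \<notin> set p" by blast
  have "is_path E (p @ [w])" using p w by (intro is_path_append) (auto simp: is_path_def)
  then show ?case using p w ne in_V[OF w(1)] by (intro exI[of _ "p @ [w]"]) auto
qed

section \<open>Joining two vertices by a short path\<close>

lemma connect_2_to_6:
  assumes "U \<subseteq> V" "card V < 3 * d" "5 * card U \<le> d + 14" "card U < d"
    and "w \<in> U" "w' \<in> U" "z \<in> U" "x \<in> U" "w \<noteq> x" "w \<noteq> w'" "w \<noteq> z" "w' \<noteq> z" "E w' w" "E z w"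
  shows "\<exists>p. is_path E p \<and> E w (hd p) \<and> E (last p) x \<and> set p \<inter> U = {} \<and> length p \<le> 5"
proof -
  interpret conv: semidegree V "\<lambda>x y. E y x" d by (rule converse)
  have fU: "finite U" using assms(1) finite_V finite_subset by blast
  define X where "X = {y. E w y} - U"
  define Y where "Y = {y. E y x} - U"
  let ?X1 = "grow E U X" and ?Y1 = "grow (\<lambda>x y. E y x) U Y"
  let ?X2 = "grow E U ?X1" and ?Y2 = "grow (\<lambda>x y. E y x) U ?Y1"
  have XU: "X \<inter> U = {}" "Y \<inter> U = {}" by (auto simp: X_def Y_def)
  have V: "X \<subseteq> V" "Y \<subseteq> V" using in_V by (auto simp: X_def Y_def)
  have V1: "?X1 \<subseteq> V" "?Y1 \<subseteq> V" using grow_subset_V conv.grow_subset_V V by auto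
  have V2: "?X2 \<subseteq> V" "?Y2 \<subseteq> V" using grow_subset_V conv.grow_subset_V V1 by auto
  \<comment> \<open>If the two balls were disjoint, they and \<open>U\<close> would together need
    more room than \<open>V\<close> has.\<close>
  have "?X2 \<inter> ?Y2 \<noteq> {}"
  proof
    assume disj: "?X2 \<inter> ?Y2 = {}"
    have sub: "X \<subseteq> ?X1" "?X1 \<subseteq> ?X2" "Y \<subseteq> ?Y1" "?Y1 \<subseteq> ?Y2" by (auto simp: grow_def)
    have U1: "?X1 \<inter> U = {}" "?Y1 \<inter> U = {}" using grow_disjoint XU by blast+
    have U2: "?X2 \<inter> U = {}" "?Y2 \<inter> U = {}" using grow_disjoint U1 by blast+
    \<comment> \<open>Disjointness itself improves the count: an arc from the out-ball to
      \<open>x\<close> would put its tail in \<open>Y\<close>, so \<open>x\<close> costs no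
      out-degree. The same holds for \<open>w\<close> on the other side.\<close>
    have to_x: "\<not> E s x" if "s \<in> ?X1" for s
    proof
      assume "E s x"
      then have "s \<in> Y" using that U1 by (auto simp: Y_def)
      then show False using that disj sub by blast
    qed
    have from_w: "\<not> E w s" if "s \<in> Y" for s
    proof
      assume "E w s"
      then have "s \<in> X" using that XU by (auto simp: X_def)
      then show False using that disj sub by blast
    qed
    \<comment> \<open>By asymmetry the in-neighbours \<open>w'\<close> and \<open>z\<close> of
      \<open>w\<close> are not lost out-neighbours.\<close>
    have "d + card {w, w', z} \<le> card X + card U"
      unfolding X_def by (rule card_out_nbrs_diff) (use assms fU irrefl asymm in auto)
    then have x0: "d + 3 \<le> card X + card U" using assms by simp
    have "d + card {x} \<le> card Y + card U"
      unfolding Y_def by (rule conv.card_out_nbrs_diff) (use assms fU irrefl asymm in auto)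
    then have y0: "d + 1 \<le> card Y + card U" by simp
    have ne: "X \<noteq> {}" "Y \<noteq> {}" using x0 y0 assms(4) by auto
    have "E w s" if "s \<in> X" for s using that by (simp add: X_def)
    then have no: "\<not> E s k" if "s \<in> X" "k \<in> {w, x}" for s k
      using that asymm to_x sub(1) by blast
    have "card X + 1 + 2 * d + 2 * card {w, x} \<le> 2 * card ?X1 + 2 * card U"
      using V ne fU assms no by (intro card_grow) auto
    then have x1: "card X + 5 + 2 * d \<le> 2 * card ?X1 + 2 * card U" using assms(9) by simp
    have "E s x" if "s \<in> Y" for s using that by (simp add: Y_def)
    then have no: "\<not> E k s" if "s \<in> Y" "k \<in> {w, x}" for s k
      using that asymm from_w by blast
    have "card Y + 1 + 2 * d + 2 * card {w, x} \<le> 2 * card ?Y1 + 2 * card U"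
      using V ne fU assms no by (intro conv.card_grow) auto
    then have y1: "card Y + 5 + 2 * d \<le> 2 * card ?Y1 + 2 * card U" using assms(9) by simp
    \<comment> \<open>Only \<open>x\<close> is spared now, since vertices of \<open>?X1\<close>
      outside \<open>X\<close> may have arcs to \<open>w\<close>.\<close>
    have "card ?X1 + 1 + 2 * d + 2 * card {x} \<le> 2 * card ?X2 + 2 * card U"
      by (rule card_grow) (use V1 ne fU assms to_x sub in auto)
    then have x2: "card ?X1 + 3 + 2 * d \<le> 2 * card ?X2 + 2 * card U" by simp
    have "\<not> E w s" if "s \<in> ?Y1" for s
    proof
      assume "E w s"
      then have "s \<in> X" using that U1 by (auto simp: X_def)
      then show False using that disj sub by blast
    qed
    then have "card ?Y1 + 1 + 2 * d + 2 * card {w} \<le> 2 * card ?Y2 + 2 * card U"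
      by (intro conv.card_grow) (use V1 ne fU assms sub in auto)
    then have y2: "card ?Y1 + 3 + 2 * d \<le> 2 * card ?Y2 + 2 * card U" by simp
    have fin: "finite ?X2" "finite ?Y2" using V2 finite_V finite_subset by blast+
    have "card ?X2 + card ?Y2 + card U = card (?X2 \<union> ?Y2 \<union> U)"
      using disj U2 fin fU by (simp add: card_Un_disjoint Int_Un_distrib2)
    also have "\<dots> \<le> card V" using V2 assms(1) finite_V by (intro card_mono) auto
    \<comment> \<open>With \<open>u = card U\<close>, four times the total is at least
      \<open>14d + 26 - 10u\<close>. As \<open>card V\<close> is at most \<open>3d - 1\<close>, this
      forces \<open>d + 15 \<le> 5u\<close>, just beyond the assumed bound.\<close>
    finally show False using x0 y0 x1 y1 x2 y2 assms(2,3) by linarith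
  qed
  then have "(grow E U ^^ 2) X \<inter> (grow (\<lambda>x y. E y x) U ^^ 2) Y \<noteq> {}"
    by (simp add: numeral_2_eq_2)
  from path_between_grow[OF XU this] show ?thesis
    by (auto simp: X_def Y_def)
qed

text \<open>The out-neighbours of \<open>s\<close> outside \<open>U\<close> are disjoint from those
  of \<open>z\<close>. Hence the out-ball of radius 2 has nearly \<open>2d\<close> vertices, and one
  growth step on each side suffices.\<close>

lemma connect_2_to_4:
  assumes "U \<subseteq> V" "card V < 3 * d" "5 * card U \<le> d + 14" "card U < d"
    and "z \<in> U" "x \<in> U" "x' \<in> U" "z \<noteq> x" "x \<noteq> x'" "E x x'"
    and s: "E z s" "s \<notin> U" "\<And>y. E z y \<Longrightarrow> E s y \<Longrightarrow> y \<in> U"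
  shows "\<exists>p. is_path E p \<and> E z (hd p) \<and> E (last p) x \<and> set p \<inter> U = {} \<and> length p \<le> 3"
proof -
  interpret conv: semidegree V "\<lambda>x y. E y x" d by (rule converse)
  have fU: "finite U" using assms(1) finite_V finite_subset by blast
  define X where "X = {y. E z y} - U"
  define Y where "Y = {y. E y x} - U"
  define N where "N = {y. E s y} - U"
  let ?X1 = "grow E U X" and ?Y1 = "grow (\<lambda>x y. E y x) U Y"
  have XU: "X \<inter> U = {}" "Y \<inter> U = {}" by (auto simp: X_def Y_def)
  have V: "X \<subseteq> V" "Y \<subseteq> V" using in_V by (auto simp: X_def Y_def)
  have V1: "?X1 \<subseteq> V" "?Y1 \<subseteq> V" using grow_subset_V conv.grow_subset_V V by auto
  have fin: "finite X" "finite N" "finite ?X1" "finite ?Y1"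
    using V V1 finite_V finite_subset by (auto simp: N_def)
  have "?X1 \<inter> ?Y1 \<noteq> {}"
  proof
    assume disj: "?X1 \<inter> ?Y1 = {}"
    have sX: "s \<in> X" using s by (simp add: X_def)
    have sub: "X \<subseteq> ?X1" "Y \<subseteq> ?Y1" by (auto simp: grow_def)
    have U1: "?X1 \<inter> U = {}" "?Y1 \<inter> U = {}" using grow_disjoint XU by blast+
    have s_x: "\<not> E s x" using sX disj sub s by (auto simp: Y_def)
    have from_z: "\<not> E z t" if "t \<in> Y" for t
    proof
      assume "E z t"
      then have "t \<in> X" using that XU by (auto simp: X_def)
      then show False using that disj sub by blast
    qed
    have "d + card {z} \<le> card X + card U"
      unfolding X_def by (rule card_out_nbrs_diff) (use assms fU irrefl in auto)
    then have x0: "d + 1 \<le> card X + card U" by simp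
    have "d + card {z, x} \<le> card N + card U"
      unfolding N_def by (rule card_out_nbrs_diff) (use assms fU asymm s_x in_V in auto)
    then have n0: "d + 2 \<le> card N + card U" using assms by simp
    have "card X + card N = card (X \<union> N)"
      using fin s(3) by (subst card_Un_disjoint) (auto simp: X_def N_def)
    also have "\<dots> \<le> card ?X1"
      using fin sX by (intro card_mono) (auto simp: grow_def N_def)
    finally have x1: "card X + card N \<le> card ?X1" .
    have "d + card {x, x'} \<le> card Y + card U"
      unfolding Y_def by (rule conv.card_out_nbrs_diff) (use assms fU irrefl asymm in auto)
    then have y0: "d + 2 \<le> card Y + card U" using assms by simp
    have ne: "Y \<noteq> {}" using y0 assms(4) by auto
    have "E s x" if "s \<in> Y" for s using that by (simp add: Y_def)
    then have no: "\<not> E k s" if "s \<in> Y" "k \<in> {z, x}" for s k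
      using that asymm from_z by blast
    have "card Y + 1 + 2 * d + 2 * card {z, x} \<le> 2 * card ?Y1 + 2 * card U"
      using V ne fU assms no by (intro conv.card_grow) auto
    then have y1: "card Y + 5 + 2 * d \<le> 2 * card ?Y1 + 2 * card U" using assms by simp
    have "card ?X1 + card ?Y1 + card U = card (?X1 \<union> ?Y1 \<union> U)"
      using disj U1 fin fU by (simp add: card_Un_disjoint Int_Un_distrib2)
    also have "\<dots> \<le> card V" using V1 assms(1) finite_V by (intro card_mono) auto
    \<comment> \<open>Twice the total is at least \<open>7d + 13 - 5u\<close> with
      \<open>u = card U\<close>, which again forces \<open>d + 15 \<le> 5u\<close>.\<close>
    finally show False using x0 n0 x1 y0 y1 assms(2,3) by linarith
  qed
  then have "(grow E U ^^ 1) X \<inter> (grow (\<lambda>x y. E y x) U ^^ 1) Y \<noteq> {}" by simp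
  from path_between_grow[OF XU this] show ?thesis
    by (auto simp: X_def Y_def)
qed

section \<open>Paths of nearly prescribed length, and the cycle\<close>

lemma ex_path_three_lengths:
  assumes "card V < 3 * d" "5 * l \<le> d + 19" "l \<ge> 9"
    and "F \<subseteq> V" "card F = 3" "y \<in> V" "x \<in> V" "y \<noteq> x" "y \<notin> F" "x \<notin> F"
  shows "\<exists>M. is_path E M \<and> hd M = y \<and> last M = x \<and> set M \<inter> F = {} \<and>
    l \<le> length M + 3 \<and> length M < l"
proof -
  interpret conv: semidegree V "\<lambda>x y. E y x" d by (rule converse)
  have fF: "finite F" using assms(4) finite_V finite_subset by blast
  have "card (insert x F) = 4" using fF assms by simp
  moreover have "card (insert x F) + (l - 9) < d" using calculation assms(2,3) by linarith
  ultimately obtain ys where ys: "is_path E ys" "length ys = Suc (l - 9)" "hd ys = y"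
      "set ys \<inter> insert x F = {}" "set ys \<subseteq> V"
    using ex_path_from[of y "insert x F" "l - 9"] fF assms by (auto simp del: disjoint_insert)
  have ne: "ys \<noteq> []" using ys(2) by auto
  define z where "z = last ys"
  have z: "z \<in> set ys" "z \<in> V" using ne ys(5) by (auto simp: z_def)
  define U where "U = insert x F \<union> set ys"
  have cys: "card (set ys) = Suc (l - 9)" using ys(1,2) by (simp add: is_path_def distinct_card)
  have UV: "U \<subseteq> V" using assms ys(5) by (auto simp: U_def)
  have fU: "finite U" using UV finite_V finite_subset by blast
  \<comment> \<open>The greedy path has \<open>l - 8\<close> vertices, and \<open>insert x F\<close>
    adds 4.\<close>
  have cU: "card U + 4 = l" unfolding U_def
    using \<open>card (insert x F) = 4\<close> cys ys(4) fF assms(3) by (subst card_Un_disjoint) auto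
  define X where "X = {w. E z w} - U"
  show ?thesis
  proof (cases "\<exists>s\<in>X. \<forall>w\<in>X. \<not> E s w")
    case True
    then obtain s where s: "s \<in> X" "\<And>w. w \<in> X \<Longrightarrow> \<not> E s w" by blast
    \<comment> \<open>The backward greedy path avoids \<open>s\<close>, so that \<open>s\<close>
      stays available to the connecting path.\<close>
    let ?G = "insert s (F \<union> set ys)"
    have "card ?G \<le> Suc (card (F \<union> set ys))" using fF by (simp add: card_insert_if)
    also have "card (F \<union> set ys) \<le> card F + card (set ys)" by (rule card_Un_le)
    finally have "card ?G + 3 < d" using cys assms(2,3,5) by linarith
    moreover have "x \<notin> ?G" using s(1) ys(4) assms by (auto simp: X_def U_def)
    ultimately obtain xs where xs: "is_path (\<lambda>x y. E y x) xs" "length xs = Suc 3" "hd xs = x"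
        "set xs \<inter> ?G = {}" "set xs \<subseteq> V"
      using conv.ex_path_from[of x ?G 3] fF assms by auto
    obtain x1 x2 x3 where xs_eq: "xs = [x, x1, x2, x3]"
      using xs(2,3) by (auto simp: length_Suc_conv numeral_3_eq_3)
    define U' where "U' = F \<union> set ys \<union> set xs"
    have "card (set xs) = 4" using xs(1,2) by (simp add: is_path_def distinct_card)
    moreover have "card U' = card F + card (set ys) + card (set xs)" unfolding U'_def
      using ys(4) xs(4) fF by (subst card_Un_disjoint; (subst card_Un_disjoint)?) auto
    ultimately have cU': "card U' + 1 = l" using cys assms(3,5) by simp
    have UU': "U \<subseteq> U'" by (auto simp: U_def U'_def xs_eq)
    have "\<exists>p. is_path E p \<and> E z (hd p) \<and> E (last p) x3 \<and> set p \<inter> U' = {} \<and> length p \<le> 3"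
    proof (rule connect_2_to_4)
      show "U' \<subseteq> V" using assms(4) ys(5) xs(5) by (auto simp: U'_def)
      show "5 * card U' \<le> d + 14" "card U' < d" using cU' assms(2,3) by linarith+
      show "z \<in> U'" "x3 \<in> U'" "x2 \<in> U'" using z by (auto simp: U'_def xs_eq)
      show "z \<noteq> x3" using z xs(4) by (auto simp: xs_eq)
      show "x3 \<noteq> x2" "E x3 x2" using xs(1) by (auto simp: is_path_def xs_eq)
      show "E z s" "s \<notin> U'" using s(1) xs(4) by (auto simp: X_def U_def U'_def)
      show "w \<in> U'" if "E z w" "E s w" for w
        using s(2)[of w] that UU' by (auto simp: X_def)
    qed (use assms in auto)
    then obtain p where p: "is_path E p" "E z (hd p)" "E (last p) x3" "set p \<inter> U' = {}"
        "length p \<le> 3" by blast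
    have pne: "length p \<ge> 1" using p(1) by (cases p) (auto simp: is_path_def)
    have "is_path E (ys @ p @ rev xs)"
      using ys(1) p xs(1,4)
      by (intro is_path_append) (auto simp: z_def is_path_rev U'_def hd_append is_path_def xs_eq)
    \<comment> \<open>The length is \<open>(l - 8) + length p + 4\<close> with
      \<open>length p\<close> between 1 and 3.\<close>
    then show ?thesis
      using ys xs p(4,5) pne ne assms(3)
      by (intro exI[of _ "ys @ p @ rev xs"]) (auto simp: U'_def xs_eq)
  next
    case False
    have "d \<le> card X + card U" unfolding X_def
      using card_out_nbrs_diff[OF z(2) fU, of "{}"] by simp
    then have "X \<noteq> {}" using cU assms(2,3) by auto
    then obtain w1 where w1: "w1 \<in> X" by blast
    then obtain w2 where w2: "w2 \<in> X" "E w1 w2" using False by blast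
    then obtain w3 where w3: "w3 \<in> X" "E w2 w3" using False by blast
    have dist: "w1 \<noteq> w2" "w2 \<noteq> w3" "w1 \<noteq> w3" using w2 w3 irrefl asymm by blast+
    have wX: "E z w1" "E z w2" "E z w3" "w1 \<notin> U" "w2 \<notin> U" "w3 \<notin> U"
      using w1 w2 w3 by (auto simp: X_def)
    define U' where "U' = U \<union> {w1, w2, w3}"
    have cU': "card U' + 1 = l" using cU dist wX fU by (simp add: U'_def)
    have "\<exists>p. is_path E p \<and> E w3 (hd p) \<and> E (last p) x \<and> set p \<inter> U' = {} \<and> length p \<le> 5"
    proof (rule connect_2_to_6)
      show "U' \<subseteq> V" using UV wX in_V by (auto simp: U'_def)
      show "5 * card U' \<le> d + 14" "card U' < d" using cU' assms(2,3) by linarith+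
      show "w3 \<in> U'" "w2 \<in> U'" "z \<in> U'" "x \<in> U'" using z by (auto simp: U'_def U_def)
      show "w3 \<noteq> x" using wX by (auto simp: U_def)
      show "w3 \<noteq> w2" "w3 \<noteq> z" "w2 \<noteq> z" "E w2 w3" "E z w3" using dist wX w3 irrefl by auto
    qed (use assms in auto)
    then obtain p where p: "is_path E p" "E w3 (hd p)" "E (last p) x" "set p \<inter> U' = {}"
        "length p \<le> 5" by blast
    have pne: "length p \<ge> 1" "p \<noteq> []" using p(1) by (cases p; auto simp: is_path_def)+
    \<comment> \<open>The total is \<open>l - 7 + length W + length p\<close>, so
      \<open>length W + length p\<close> must lie between 4 and 6. A suffix of
      \<open>w1, w2, w3\<close> achieves this, and each of its vertices is an out-neighbour of
      \<open>z\<close>.\<close>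
    define W where "W = (if length p = 1 then [w1, w2, w3] else if length p < 5 then [w2, w3] else [w3])"
    have W: "is_path E W" "E z (hd W)" "last W = w3" "set W \<subseteq> {w1, w2, w3}" "W \<noteq> []"
      using dist w2 w3 wX by (auto simp: W_def is_path_def)
    have "is_path E (ys @ W @ p @ [x])"
      using ys(1,4) p W wX
      by (intro is_path_append) (auto simp: z_def U'_def U_def hd_append is_path_def)
    moreover have "l \<le> length (ys @ W @ p @ [x]) + 3" "length (ys @ W @ p @ [x]) < l"
      using ys(2) p(5) pne(1) assms(3) by (auto simp: W_def)
    moreover have "set (ys @ W @ p @ [x]) \<inter> F = {}"
      using ys(4) W(4) p(4) wX assms by (auto simp: U'_def U_def)
    ultimately show ?thesis
      using ys(3) ne by (intro exI[of _ "ys @ W @ p @ [x]"]) auto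
  qed
qed

lemma ex_cycle_through:
  assumes "card V < 3 * d" "5 * l \<le> d + 19" "l \<ge> 9" "v \<in> V"
  shows "\<exists>c. is_path E (v # c) \<and> length (v # c) = l \<and> E (last (v # c)) v"
proof -
  interpret conv: semidegree V "\<lambda>x y. E y x" d by (rule converse)
  obtain b y where b: "E v b" "E v y" "E b y" using arc_in_out_nbrs assms by blast
  obtain a x where a: "E a v" "E x v" "E x a" using conv.arc_in_out_nbrs assms by blast
  have dist: "v \<noteq> a" "v \<noteq> b" "v \<noteq> x" "v \<noteq> y" "a \<noteq> x" "a \<noteq> b" "a \<noteq> y" "x \<noteq> b" "x \<noteq> y" "b \<noteq> y"
    using a b irrefl asymm by blast+
  have V: "{v, a, b, x, y} \<subseteq> V" using a b in_V by blast
  obtain M where M: "is_path E M" "hd M = y" "last M = x" "set M \<inter> {v, a, b} = {}"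
      "l \<le> length M + 3" "length M < l"
    using ex_path_three_lengths[of l "{v, a, b}" y x] assms dist V by auto
  have ne: "M \<noteq> []" "is_path E M" using M(1) by (auto simp: is_path_def)
  \<comment> \<open>The missing vertices are \<open>v\<close> alone, \<open>v\<close> and
    \<open>b\<close>, or all of \<open>v\<close>, \<open>b\<close> and \<open>a\<close>.\<close>
  consider "l = length M + 1" | "l = length M + 2" | "l = length M + 3" using M(5,6) by linarith
  then show ?thesis
  proof cases
    case 1
    have "is_path E ([v] @ M)" by (rule is_path_append) (use M b in \<open>auto simp: is_path_def\<close>)
    then show ?thesis using 1 M a ne by (intro exI[of _ M]) auto
  next
    case 2
    have "is_path E ([v, b] @ M)"
      by (rule is_path_append) (use M b dist in \<open>auto simp: is_path_def\<close>)
    then show ?thesis using 2 M a ne by (intro exI[of _ "b # M"]) auto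
  next
    case 3
    have "is_path E ([v, b] @ M)"
      by (rule is_path_append) (use M b dist in \<open>auto simp: is_path_def\<close>)
    then have "is_path E (([v, b] @ M) @ [a])"
      by (rule is_path_append) (use M a ne dist in \<open>auto simp: is_path_def\<close>)
    then show ?thesis using 3 M a ne by (intro exI[of _ "b # M @ [a]"]) auto
  qed
qed

end

section \<open>Transfer to arc walks in digraphs\<close>

lemma (in wf_digraph) awalk_if_successively_dominates:
  assumes "successively (\<lambda>x y. (x, y) \<in> arcs_ends G) (u # vs)" "u \<in> verts G"
  shows "\<exists>p. awalk u p (last (u # vs)) \<and> awalk_verts u p = u # vs"
  using assms
proof (induction vs arbitrary: u)
  case Nil
  then show ?case by (intro exI[of _ "[]"]) (simp add: awalk_Nil_iff)
next
  case (Cons w vs)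
  then obtain e where e: "e \<in> arcs G" "tail G e = u" "head G e = w"
    by (auto simp: arcs_ends_conv)
  then obtain p where "awalk w p (last (w # vs))" "awalk_verts w p = w # vs"
    using Cons by fastforce
  then show ?case using e Cons.prems(2)
    by (intro exI[of _ "e # p"]) (auto simp: awalk_Cons_iff)
qed

lemma (in wf_digraph) on_directed_cycleI:
  assumes "is_path (\<lambda>x y. (x, y) \<in> arcs_ends G) (v # c)" "(last (v # c), v) \<in> arcs_ends G"
  shows "on_directed_cycle G (length (v # c)) v"
proof -
  let ?E = "\<lambda>x y. (x, y) \<in> arcs_ends G"
  have v: "v \<in> verts G" using assms(2) by (auto simp: arcs_ends_conv)
  have "successively ?E ((v # c) @ [v])"
    using assms by (auto simp: is_path_def successively_append_iff simp del: append_Cons)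
  then obtain p where p: "awalk v p v" "awalk_verts v p = v # c @ [v]"
    using awalk_if_successively_dominates[of v "c @ [v]"] v by auto
  have len: "length p = length (v # c)" using length_awalk_verts[of v p] p(2) by simp
  then obtain e es where pe: "p = e # es" by (cases p) auto
  have "cycle p" unfolding cycle_def using p assms(1) pe by (auto simp: is_path_def)
  moreover have "tail G e = v" using p(2) pe by simp
  ultimately show ?thesis unfolding on_directed_cycle_def using len pe by (intro exI[of _ p]) auto
qed

lemma (in oriented_graph) semidegree_dominates:
  assumes "d \<le> min_semidegree G"
  shows "semidegree (verts G) (\<lambda>x y. (x, y) \<in> arcs_ends G) d"
proof
  fix x y assume "(x, y) \<in> arcs_ends G"
  then show "x \<in> verts G \<and> y \<in> verts G" by (auto simp: arcs_ends_conv)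
next
  fix x y assume "(x, y) \<in> arcs_ends G"
  then show "(y, x) \<notin> arcs_ends G" using asym_arcs by (rule asymD[rotated])
next
  fix x assume x: "x \<in> verts G"
  have "min_semidegree G \<le> min (out_degree G x) (in_degree G x)"
    using x unfolding min_semidegree_def by (intro Min_le) auto
  then have "d \<le> min (out_degree G x) (in_degree G x)" using assms by simp
  \<comment> \<open>Without parallel arcs, \<open>head G\<close> is injective on the out-arcs of
    \<open>x\<close>, so the out-degree counts out-neighbours.\<close>
  moreover have "card (out_arcs G x) = card {y. (x, y) \<in> arcs_ends G}"
    by (intro bij_betw_same_card[of "head G"])
      (auto simp: bij_betw_def inj_on_def arcs_ends_conv arc_to_ends_def intro!: no_multi_arcs)
  moreover have "card (in_arcs G x) = card {y. (y, x) \<in> arcs_ends G}"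
    by (intro bij_betw_same_card[of "tail G"])
      (auto simp: bij_betw_def inj_on_def arcs_ends_conv arc_to_ends_def intro!: no_multi_arcs)
  ultimately show "d \<le> card {y. (x, y) \<in> arcs_ends G}" "d \<le> card {y. (y, x) \<in> arcs_ends G}"
    by (auto simp: out_degree_def in_degree_def)
qed simp

theorem corollary2p8:
  fixes G :: "('a, 'b) pre_digraph" and q n :: nat
  assumes "q \<ge> 3"
    and "\<not> 3 dvd n"
    and "int n \<ge> 45 * int q - 60"
    and "oriented_graph G"
    and "card (verts G) = n"
    and "int (min_semidegree G) \<ge> \<lceil>real n / 3\<rceil>"
  shows "\<forall>v \<in> verts G. on_directed_cycle G (3 * q) v"
proof
  fix v assume v: "v \<in> verts G"
  interpret oriented_graph G by fact
  let ?d = "min_semidegree G"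
  interpret semidegree "verts G" "\<lambda>x y. (x, y) \<in> arcs_ends G" ?d
    by (rule semidegree_dominates) simp
  have "real n / 3 \<le> real ?d" using assms(6) by linarith
  then have "n \<le> 3 * ?d" by linarith
  \<comment> \<open>Non-divisibility by 3 makes the semidegree bound strict, as the ball counting
    requires.\<close>
  moreover have "n \<noteq> 3 * ?d" using assms(2) by auto
  ultimately have "n < 3 * ?d" by linarith
  \<comment> \<open>From \<open>3 * ?d \<ge> n + 1 \<ge> 45q - 59\<close>, integrality gives
    \<open>?d \<ge> 15q - 19\<close>, which is \<open>5 * l \<le> ?d + 19\<close> for
    \<open>l = 3 * q\<close>.\<close>
  then obtain c where "is_path (\<lambda>x y. (x, y) \<in> arcs_ends G) (v # c)" "length (v # c) = 3 * q"
      "(last (v # c), v) \<in> arcs_ends G"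
    using ex_cycle_through[of "3 * q" v] assms(1,3,5) v by auto
  then show "on_directed_cycle G (3 * q) v" using on_directed_cycleI by metis
qed

end
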